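(* Let $\Gamma=(\pi,\mathcal{C},\Sigma)$ be a concrete data type definition, $\mathcal{E}$ a finite set of equations between terms of sort $\pi$ (possibly with variables), and $f:\mathcal{T}_\pi\to\mathcal{T}_\pi$ a valid normalization function for $(\Gamma,\mathcal{E})$. Define the family $(f_C)_{C\in\mathcal{C}}$ by $f_C(t_1,\ldots,t_n)=f(C(t_1,\ldots,t_n))$ for every $C:\sigma_1\ldots\sigma_n\pi$ and $t_i\in\mathcal{T}_{\sigma_i}$. Then this family of construction functions is valid with respect to $\mathcal{E}$.
   Context: Fix a set $\mathcal{S}_0$ of primitive sorts and a set $\mathcal{C}_0$ of primitive constants, each having a sort in $\mathcal{S}_0$. A concrete data type definition is a triple $\Gamma=(\pi,\mathcal{C},\Sigma)$ where $\pi\notin\mathcal{S}_0$ is a sort, $\mathcal{C}$ is a non-empty set of constructor symbols, and $\Sigma$ assigns to every $C\in\mathcal{C}$ a sequence $\sigma_1\ldots\sigma_n\pi$ ($n\ge0$, each $\sigma_i\in\mathcal{S}_0\cup\{\pi\}$), written $C:\sigma_1\ldots\sigma_n\pi$. $\mathcal{T}_\sigma$ is the set of variable-free well-sorted terms of sort $\sigma$ over $\mathcal{C}_0\cup\mathcal{C}$. $=_\mathcal{E}$ is the smallest congruence on terms containing $\mathcal{E}$ (closed under substitution instances, contexts, reflexivity, symmetry, transitivity). A map $f:\mathcal{T}_\pi\to\mathcal{T}_\pi$ is a valid normalization function for $(\Gamma,\mathcal{E})$ if $f(t)=_\mathcal{E}t$ for all $t\in\mathcal{T}_\pi$ and $f(t)=f(u)$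 whenever $t=_\mathcal{E}u$. For a family of construction functions $\mathcal{F}=(f_C)_{C\in\mathcal{C}}$ (with $f_C:\mathcal{T}_{\sigma_1}\times\cdots\times\mathcal{T}_{\sigma_n}\to\mathcal{T}_\pi$), values are: $\mathrm{Val}(\sigma)=\mathcal{T}_\sigma$ for $\sigma\in\mathcal{S}_0$, and $\mathrm{Val}(\pi)$ is the smallest set containing $f_C(v_1,\ldots,v_n)$ for all $C:\sigma_1\ldots\sigma_n\pi$ and $v_i\in\mathrm{Val}(\sigma_i)$. $\mathcal{F}$ is valid with respect to $\mathcal{E}$ if (correctness) for all $C:\sigma_1\ldots\sigma_n\pi$ and $v_i\in\mathrm{Val}(\sigma_i)$, $f_C(v_1,\ldots,v_n)=_\mathcal{E}C(v_1,\ldots,v_n)$; and (completeness) for all $C:\sigma_1\ldots\sigma_n\pi$, $v_i\in\mathrm{Val}(\sigma_i)$, $D:\tau_1\ldots\tau_p\pi$, $w_j\in\mathrm{Val}(\tau_j)$, if $C(v_1,\ldots,v_n)=_\mathcal{E}D(w_1,\ldots,w_p)$ then $f_C(v_1,\ldots,v_n)=f_D(w_1,\ldots,w_p)$. *)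

theory Defs
  imports Main "HOL-Library.FuncSet"
begin

record ('s, 'k) primitives =
  prim_sorts :: "'s set"
  prim_consts :: "'k set"
  const_sort :: "'k \<Rightarrow> 's"

text \<open>A constructor declaration \<open>C : \<sigma>\<^sub>1 \<dots> \<sigma>\<^sub>n \<pi>\<close> is stored as the list
  \<open>arg_sorts \<Gamma> C = [\<sigma>\<^sub>1, \<dots>, \<sigma>\<^sub>n]\<close>; the last sort of the sequence is always \<open>\<pi> = cdt_sort \<Gamma>\<close>.\<close>

record ('s, 'c) cdt =
  cdt_sort :: 's
  constructors :: "'c set"
  arg_sorts :: "'c \<Rightarrow> 's list"

definition wf_primitives :: "('s, 'k) primitives \<Rightarrow> bool" where
  "wf_primitives P \<longleftrightarrow> const_sort P \<in> prim_consts P \<rightarrow> prim_sorts P"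

definition sorts :: "('s, 'k) primitives \<Rightarrow> ('s, 'c) cdt \<Rightarrow> 's set" where
  "sorts P \<Gamma> = prim_sorts P \<union> {cdt_sort \<Gamma>}"

definition concrete_data_type :: "('s, 'k) primitives \<Rightarrow> ('s, 'c) cdt \<Rightarrow> bool" where
  "concrete_data_type P \<Gamma> \<longleftrightarrow>
     cdt_sort \<Gamma> \<notin> prim_sorts P \<and> constructors \<Gamma> \<noteq> {} \<and>
     (\<forall>C \<in> constructors \<Gamma>. set (arg_sorts \<Gamma> C) \<subseteq> sorts P \<Gamma>)"

text \<open>A variable consists of a name and its sort, so each sort has its own copy of the names.\<close>

datatype ('v, 's, 'k, 'c) trm =
  Var 'v 's
| Const 'k
| App 'c "('v, 's, 'k, 'c) trm list"

inductive has_sort ::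
  "('s, 'k) primitives \<Rightarrow> ('s, 'c) cdt \<Rightarrow> ('v, 's, 'k, 'c) trm \<Rightarrow> 's \<Rightarrow> bool"
  for P \<Gamma> where
  Var: "s \<in> sorts P \<Gamma> \<Longrightarrow> has_sort P \<Gamma> (Var x s) s"
| Const: "k \<in> prim_consts P \<Longrightarrow> has_sort P \<Gamma> (Const k) (const_sort P k)"
| App: "C \<in> constructors \<Gamma> \<Longrightarrow> list_all2 (has_sort P \<Gamma>) ts (arg_sorts \<Gamma> C)
    \<Longrightarrow> has_sort P \<Gamma> (App C ts) (cdt_sort \<Gamma>)"

fun vars :: "('v, 's, 'k, 'c) trm \<Rightarrow> ('v \<times> 's) set" where
  "vars (Var x s) = {(x, s)}"
| "vars (Const k) = {}"
| "vars (App C ts) = (\<Union>t \<in> set ts. vars t)"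

definition ground_terms ::
  "('s, 'k) primitives \<Rightarrow> ('s, 'c) cdt \<Rightarrow> 's \<Rightarrow> ('v, 's, 'k, 'c) trm set" where
  "ground_terms P \<Gamma> s = {t. has_sort P \<Gamma> t s \<and> vars t = {}}"

fun subst :: "('v \<Rightarrow> 's \<Rightarrow> ('v, 's, 'k, 'c) trm) \<Rightarrow> ('v, 's, 'k, 'c) trm \<Rightarrow> ('v, 's, 'k, 'c) trm"
  where
  "subst \<theta> (Var x s) = \<theta> x s"
| "subst \<theta> (Const k) = Const k"
| "subst \<theta> (App C ts) = App C (map (subst \<theta>) ts)"

definition well_sorted_subst ::
  "('s, 'k) primitives \<Rightarrow> ('s, 'c) cdt \<Rightarrow> ('v \<Rightarrow> 's \<Rightarrow> ('v, 's, 'k, 'c) trm) \<Rightarrow> bool" where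
  "well_sorted_subst P \<Gamma> \<theta> \<longleftrightarrow> (\<forall>x. \<forall>s \<in> sorts P \<Gamma>. has_sort P \<Gamma> (\<theta> x s) s)"

definition equations ::
  "('s, 'k) primitives \<Rightarrow> ('s, 'c) cdt \<Rightarrow> (('v, 's, 'k, 'c) trm \<times> ('v, 's, 'k, 'c) trm) set \<Rightarrow> bool"
  where
  "equations P \<Gamma> E \<longleftrightarrow>
     (\<forall>(l, r) \<in> E. has_sort P \<Gamma> l (cdt_sort \<Gamma>) \<and> has_sort P \<Gamma> r (cdt_sort \<Gamma>))"

text \<open>The relation is generated on all well-sorted terms, variables included, so a derivation
  between two ground terms may pass through terms with variables.\<close>

inductive eq_mod ::
  "('s, 'k) primitives \<Rightarrow> ('s, 'c) cdt \<Rightarrow> (('v, 's, 'k, 'c) trm \<times> ('v, 's, 'k, 'c) trm) set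
    \<Rightarrow> ('v, 's, 'k, 'c) trm \<Rightarrow> ('v, 's, 'k, 'c) trm \<Rightarrow> bool"
  for P \<Gamma> E where
  axiom: "(l, r) \<in> E \<Longrightarrow> eq_mod P \<Gamma> E l r"
| inst: "eq_mod P \<Gamma> E t u \<Longrightarrow> well_sorted_subst P \<Gamma> \<theta> \<Longrightarrow> eq_mod P \<Gamma> E (subst \<theta> t) (subst \<theta> u)"
| ctxt: "eq_mod P \<Gamma> E t u \<Longrightarrow> has_sort P \<Gamma> (App C (ts @ t # us)) (cdt_sort \<Gamma>)
    \<Longrightarrow> eq_mod P \<Gamma> E (App C (ts @ t # us)) (App C (ts @ u # us))"
| refl: "has_sort P \<Gamma> t s \<Longrightarrow> eq_mod P \<Gamma> E t t"
| sym: "eq_mod P \<Gamma> E t u \<Longrightarrow> eq_mod P \<Gamma> E u t"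
| trans: "eq_mod P \<Gamma> E t u \<Longrightarrow> eq_mod P \<Gamma> E u v \<Longrightarrow> eq_mod P \<Gamma> E t v"

definition valid_normalization ::
  "('s, 'k) primitives \<Rightarrow> ('s, 'c) cdt \<Rightarrow> (('v, 's, 'k, 'c) trm \<times> ('v, 's, 'k, 'c) trm) set
    \<Rightarrow> (('v, 's, 'k, 'c) trm \<Rightarrow> ('v, 's, 'k, 'c) trm) \<Rightarrow> bool" where
  "valid_normalization P \<Gamma> E f \<longleftrightarrow>
     (\<forall>t \<in> ground_terms P \<Gamma> (cdt_sort \<Gamma>). eq_mod P \<Gamma> E (f t) t) \<and>
     (\<forall>t \<in> ground_terms P \<Gamma> (cdt_sort \<Gamma>). \<forall>u \<in> ground_terms P \<Gamma> (cdt_sort \<Gamma>).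
        eq_mod P \<Gamma> E t u \<longrightarrow> f t = f u)"

definition ground_args ::
  "('s, 'k) primitives \<Rightarrow> ('s, 'c) cdt \<Rightarrow> 'c \<Rightarrow> ('v, 's, 'k, 'c) trm list set" where
  "ground_args P \<Gamma> C = {ts. list_all2 (\<lambda>t s. t \<in> ground_terms P \<Gamma> s) ts (arg_sorts \<Gamma> C)}"

definition construction_functions ::
  "('s, 'k) primitives \<Rightarrow> ('s, 'c) cdt
    \<Rightarrow> ('c \<Rightarrow> ('v, 's, 'k, 'c) trm list \<Rightarrow> ('v, 's, 'k, 'c) trm) \<Rightarrow> bool" where
  "construction_functions P \<Gamma> F \<longleftrightarrow>
     (\<forall>C \<in> constructors \<Gamma>. F C \<in> ground_args P \<Gamma> C \<rightarrow> ground_terms P \<Gamma> (cdt_sort \<Gamma>))"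

inductive is_val ::
  "('s, 'k) primitives \<Rightarrow> ('s, 'c) cdt
    \<Rightarrow> ('c \<Rightarrow> ('v, 's, 'k, 'c) trm list \<Rightarrow> ('v, 's, 'k, 'c) trm)
    \<Rightarrow> ('v, 's, 'k, 'c) trm \<Rightarrow> 's \<Rightarrow> bool"
  for P \<Gamma> F where
  prim: "s \<in> prim_sorts P \<Longrightarrow> t \<in> ground_terms P \<Gamma> s \<Longrightarrow> is_val P \<Gamma> F t s"
| constr: "C \<in> constructors \<Gamma> \<Longrightarrow> list_all2 (is_val P \<Gamma> F) vs (arg_sorts \<Gamma> C)
    \<Longrightarrow> is_val P \<Gamma> F (F C vs) (cdt_sort \<Gamma>)"

definition val_args ::
  "('s, 'k) primitives \<Rightarrow> ('s, 'c) cdt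
    \<Rightarrow> ('c \<Rightarrow> ('v, 's, 'k, 'c) trm list \<Rightarrow> ('v, 's, 'k, 'c) trm)
    \<Rightarrow> 'c \<Rightarrow> ('v, 's, 'k, 'c) trm list set" where
  "val_args P \<Gamma> F C = {vs. list_all2 (is_val P \<Gamma> F) vs (arg_sorts \<Gamma> C)}"

definition correct ::
  "('s, 'k) primitives \<Rightarrow> ('s, 'c) cdt \<Rightarrow> (('v, 's, 'k, 'c) trm \<times> ('v, 's, 'k, 'c) trm) set
    \<Rightarrow> ('c \<Rightarrow> ('v, 's, 'k, 'c) trm list \<Rightarrow> ('v, 's, 'k, 'c) trm) \<Rightarrow> bool" where
  "correct P \<Gamma> E F \<longleftrightarrow>
     (\<forall>C \<in> constructors \<Gamma>. \<forall>vs \<in> val_args P \<Gamma> F C. eq_mod P \<Gamma> E (F C vs) (App C vs))"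

definition complete ::
  "('s, 'k) primitives \<Rightarrow> ('s, 'c) cdt \<Rightarrow> (('v, 's, 'k, 'c) trm \<times> ('v, 's, 'k, 'c) trm) set
    \<Rightarrow> ('c \<Rightarrow> ('v, 's, 'k, 'c) trm list \<Rightarrow> ('v, 's, 'k, 'c) trm) \<Rightarrow> bool" where
  "complete P \<Gamma> E F \<longleftrightarrow>
     (\<forall>C \<in> constructors \<Gamma>. \<forall>vs \<in> val_args P \<Gamma> F C.
      \<forall>D \<in> constructors \<Gamma>. \<forall>ws \<in> val_args P \<Gamma> F D.
        eq_mod P \<Gamma> E (App C vs) (App D ws) \<longrightarrow> F C vs = F D ws)"

definition valid_construction ::
  "('s, 'k) primitives \<Rightarrow> ('s, 'c) cdt \<Rightarrow> (('v, 's, 'k, 'c) trm \<times> ('v, 's, 'k, 'c) trm) set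
    \<Rightarrow> ('c \<Rightarrow> ('v, 's, 'k, 'c) trm list \<Rightarrow> ('v, 's, 'k, 'c) trm) \<Rightarrow> bool" where
  "valid_construction P \<Gamma> E F \<longleftrightarrow> correct P \<Gamma> E F \<and> complete P \<Gamma> E F"

end

theory Submission
  imports Defs
begin

text \<open>Both clauses of validity are instances of the two properties of \<open>f\<close>, taken
  at the terms \<open>App C vs\<close> with \<open>vs\<close> values: \<open>f t\<close> equal to
  \<open>t\<close> modulo \<open>E\<close> gives correctness, and \<open>f\<close> being constant on
  classes modulo \<open>E\<close> gives completeness. What needs an argument is that these terms lie
  where \<open>f\<close> is controlled, namely among the ground terms of sort
  \<open>cdt_sort \<Gamma>\<close>. This follows from \<open>is_val_in_ground_terms\<close> for the
  arguments and \<open>App_in_ground_terms\<close> for the application.\<close>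

lemma App_in_ground_terms:
  assumes "C \<in> constructors \<Gamma>" "ts \<in> ground_args P \<Gamma> C"
  shows "App C ts \<in> ground_terms P \<Gamma> (cdt_sort \<Gamma>)"
proof -
  have ground: "list_all2 (\<lambda>t s. t \<in> ground_terms P \<Gamma> s) ts (arg_sorts \<Gamma> C)"
    using assms(2) by (simp add: ground_args_def)
  then have "list_all2 (has_sort P \<Gamma>) ts (arg_sorts \<Gamma> C)"
    by (rule list_all2_mono) (simp add: ground_terms_def)
  moreover have "\<forall>t \<in> set ts. vars t = {}"
    using ground by (auto simp: list_all2_conv_all_nth in_set_conv_nth ground_terms_def)
  ultimately show ?thesis
    using assms(1) by (auto simp: ground_terms_def intro: has_sort.App)
qed

text \<open>Induction on the generation of values: the typing of \<open>F\<close> carries groundness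
  from the arguments to the value constructed from them.\<close>

lemma is_val_in_ground_terms:
  assumes "construction_functions P \<Gamma> F" "is_val P \<Gamma> F t s"
  shows "t \<in> ground_terms P \<Gamma> s"
  using assms(2)
proof induction
  case (prim s t)
  then show ?case by simp
next
  case (constr C vs)
  \<comment> \<open>Inside \<open>list_all2\<close>, the induction hypothesis is conjoined with
    \<open>is_val\<close>; monotonicity keeps only the groundness.\<close>
  then have "vs \<in> ground_args P \<Gamma> C"
    unfolding ground_args_def by (auto elim: list_all2_mono)
  then show ?case
    using assms(1) constr(1) by (auto simp: construction_functions_def)
qed

lemma val_args_subset_ground_args:
  assumes "construction_functions P \<Gamma> F"
  shows "val_args P \<Gamma> F C \<subseteq> ground_args P \<Gamma> C"
  using is_val_in_ground_terms[OF assms]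
  by (auto simp: val_args_def ground_args_def elim: list_all2_mono)

theorem theorem2:
  fixes P :: "('s, 'k) primitives"
    and \<Gamma> :: "('s, 'c) cdt"
    and E :: "(('v, 's, 'k, 'c) trm \<times> ('v, 's, 'k, 'c) trm) set"
    and f :: "('v, 's, 'k, 'c) trm \<Rightarrow> ('v, 's, 'k, 'c) trm"
    and F :: "'c \<Rightarrow> ('v, 's, 'k, 'c) trm list \<Rightarrow> ('v, 's, 'k, 'c) trm"
  assumes "wf_primitives P"
    and "concrete_data_type P \<Gamma>"
    and "finite E" and "equations P \<Gamma> E"
    and "f \<in> ground_terms P \<Gamma> (cdt_sort \<Gamma>) \<rightarrow> ground_terms P \<Gamma> (cdt_sort \<Gamma>)"
    and "valid_normalization P \<Gamma> E f"
    and "\<And>C ts. C \<in> constructors \<Gamma> \<Longrightarrow> ts \<in> ground_args P \<Gamma> C \<Longrightarrow> F C ts = f (App C ts)"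
  shows "construction_functions P \<Gamma> F \<and> valid_construction P \<Gamma> E F"
proof -
  have normal: "eq_mod P \<Gamma> E (f t) t"
    if "t \<in> ground_terms P \<Gamma> (cdt_sort \<Gamma>)" for t
    using assms(6) that by (simp add: valid_normalization_def)
  have unique: "f t = f u"
    if "t \<in> ground_terms P \<Gamma> (cdt_sort \<Gamma>)" "u \<in> ground_terms P \<Gamma> (cdt_sort \<Gamma>)"
      "eq_mod P \<Gamma> E t u" for t u
    using assms(6) that by (simp add: valid_normalization_def)
  \<comment> \<open>Typing comes before validity, since groundness of values rests on it.\<close>
  have F: "construction_functions P \<Gamma> F"
    unfolding construction_functions_def
  proof (intro ballI Pi_I)
    fix C and ts :: "('v, 's, 'k, 'c) trm list"
    assume "C \<in> constructors \<Gamma>" "ts \<in> ground_args P \<Gamma> C"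
    then show "F C ts \<in> ground_terms P \<Gamma> (cdt_sort \<Gamma>)"
      using funcset_mem[OF assms(5) App_in_ground_terms] by (simp add: assms(7))
  qed
  \<comment> \<open>The equation for \<open>F\<close> is assumed on ground arguments only; it
    reaches values because they are ground.\<close>
  have val: "F C vs = f (App C vs)" "App C vs \<in> ground_terms P \<Gamma> (cdt_sort \<Gamma>)"
    if "C \<in> constructors \<Gamma>" "vs \<in> val_args P \<Gamma> F C" for C vs
  proof -
    have "vs \<in> ground_args P \<Gamma> C"
      using that(2) val_args_subset_ground_args[OF F] by (rule rev_subsetD)
    with that(1) show "F C vs = f (App C vs)" "App C vs \<in> ground_terms P \<Gamma> (cdt_sort \<Gamma>)"
      by (rule assms(7), rule App_in_ground_terms)
  qed
  have "correct P \<Gamma> E F"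
    by (auto simp: correct_def val normal)
  moreover have "complete P \<Gamma> E F"
    by (auto simp: complete_def val unique)
  ultimately show ?thesis
    using F by (simp add: valid_construction_def)
qed

end
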